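(* For every $\boldsymbol x\in\prod_{v\in V}\mathcal X_v$, $$(1-1/e)\,\hat f(\boldsymbol x)\ \le\ \mathbb E_{\boldsymbol\xi\sim D(\boldsymbol x)}[f(\boldsymbol x,\boldsymbol\xi)]\ \le\ \hat f(\boldsymbol x),$$ where $f(\boldsymbol x,\boldsymbol\xi)$ is the optimal value of the b-matching problem with random capacities $\boldsymbol\xi$, and $\hat f(\boldsymbol x)$ is the optimal value of its linear relaxation with the capacities replaced by their means (both defined in the context).
   Context: $G=(U,V,E)$ is a finite bipartite graph with edges $e=(u,v)$, $u\in U$, $v\in V$; $\delta(a)$ is the set of edges incident to node $a$, assumed non-empty for every $a\in U\cup V$. Each edge $e$ has a weight $w_e\in\mathbb R$; each $u\in U$ has a capacity $c_u\in\mathbb Z_{>0}$. For each $v\in V$: $n_v$ is a non-negative integer, $\mathcal X_v\subseteq\mathbb R$ is an interval, $p_v:\mathcal X_v\to[0,1]$ is a function, and $\bar\xi_v(x):=n_vp_v(x)$. For $\boldsymbol x\in\prod_v\mathcal X_v$, $D(\boldsymbol x)=\prod_{v\in V}D_v(\boldsymbol x)$ is the product distribution (independent coordinates), where either $D_v(\boldsymbol x)=\mathrm{Bin}(n_v,p_v(x_v))$ for all $v\in V$, or $D_v(\boldsymbol x)=\mathrm{Poisson}(n_vp_v(x_v))$ for all $v\in V$ (the statement covers both cases). $f(\boldsymbol x,\boldsymbol\xi)$ is the optimal value of: maximize $\sum_{e=(u,v)\in E}(w_e+x_v)z_e$ over $\boldsymbol z\in\mathbb Z_{\ge0}^E$ subject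 to $\sum_{e\in\delta(v)}z_e\le\xi_v$ for all $v\in V$ and $\sum_{e\in\delta(u)}z_e\le c_u$ for all $u\in U$. $\hat f(\boldsymbol x)$ is the optimal value of: maximize $\sum_{e=(u,v)\in E}(x_v+w_e)z_e$ over $\boldsymbol z\in\mathbb R_{\ge0}^E$ subject to $\sum_{e\in\delta(v)}z_e\le\bar\xi_v(x_v)$ for all $v\in V$ and $\sum_{e\in\delta(u)}z_e\le c_u$ for all $u\in U$. In the inequality, $e$ in $1-1/e$ denotes Euler's number. *)

theory Defs
  imports "HOL-Probability.Probability"
begin

text \<open>
  The two sides of the bipartite graph are finite sets of two (possibly different) types, so they
  are disjoint by construction; an edge is a pair \<^term>\<open>(u, v)\<close>.
\<close>

definition edges_at_left :: "('u \<times> 'v) set \<Rightarrow> 'u \<Rightarrow> ('u \<times> 'v) set" where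
  "edges_at_left E u = {e \<in> E. fst e = u}"

definition edges_at_right :: "('u \<times> 'v) set \<Rightarrow> 'v \<Rightarrow> ('u \<times> 'v) set" where
  "edges_at_right E v = {e \<in> E. snd e = v}"

definition bipartite_graph :: "'u set \<Rightarrow> 'v set \<Rightarrow> ('u \<times> 'v) set \<Rightarrow> bool" where
  "bipartite_graph U V E \<longleftrightarrow>
     finite U \<and> finite V \<and> E \<subseteq> U \<times> V \<and>
     (\<forall>u\<in>U. edges_at_left E u \<noteq> {}) \<and> (\<forall>v\<in>V. edges_at_right E v \<noteq> {})"

definition matching_value ::
  "('u \<times> 'v) set \<Rightarrow> ('u \<times> 'v \<Rightarrow> real) \<Rightarrow> ('v \<Rightarrow> real) \<Rightarrow> ('u \<times> 'v \<Rightarrow> real) \<Rightarrow> real" where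
  "matching_value E w x z = (\<Sum>e\<in>E. (w e + x (snd e)) * z e)"

definition feasible_b_matchings ::
  "'u set \<Rightarrow> 'v set \<Rightarrow> ('u \<times> 'v) set \<Rightarrow> ('u \<Rightarrow> nat) \<Rightarrow> ('v \<Rightarrow> nat) \<Rightarrow> ('u \<times> 'v \<Rightarrow> nat) set" where
  "feasible_b_matchings U V E c \<xi> =
     {z. (\<forall>v\<in>V. (\<Sum>e\<in>edges_at_right E v. z e) \<le> \<xi> v) \<and>
         (\<forall>u\<in>U. (\<Sum>e\<in>edges_at_left E u. z e) \<le> c u)}"

definition feasible_fractional ::
  "'u set \<Rightarrow> 'v set \<Rightarrow> ('u \<times> 'v) set \<Rightarrow> ('u \<Rightarrow> nat) \<Rightarrow> ('v \<Rightarrow> real) \<Rightarrow> ('u \<times> 'v \<Rightarrow> real) set" where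
  "feasible_fractional U V E c b =
     {z. (\<forall>e\<in>E. 0 \<le> z e) \<and>
         (\<forall>v\<in>V. (\<Sum>e\<in>edges_at_right E v. z e) \<le> b v) \<and>
         (\<forall>u\<in>U. (\<Sum>e\<in>edges_at_left E u. z e) \<le> real (c u))}"

text \<open>
  Optimal values are suprema in the reals. Both feasible regions are non-empty and have bounded
  objective values (lemmas below), so these are genuine suprema.
\<close>

definition b_matching_opt ::
  "'u set \<Rightarrow> 'v set \<Rightarrow> ('u \<times> 'v) set \<Rightarrow> ('u \<times> 'v \<Rightarrow> real) \<Rightarrow> ('u \<Rightarrow> nat) \<Rightarrow>
   ('v \<Rightarrow> real) \<Rightarrow> ('v \<Rightarrow> nat) \<Rightarrow> real" where
  "b_matching_opt U V E w c x \<xi> =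
     (SUP z \<in> feasible_b_matchings U V E c \<xi>. matching_value E w x (\<lambda>e. real (z e)))"

definition mean_demand :: "('v \<Rightarrow> nat) \<Rightarrow> ('v \<Rightarrow> real \<Rightarrow> real) \<Rightarrow> 'v \<Rightarrow> real \<Rightarrow> real" where
  "mean_demand n p v y = real (n v) * p v y"

definition fluid_opt ::
  "'u set \<Rightarrow> 'v set \<Rightarrow> ('u \<times> 'v) set \<Rightarrow> ('u \<times> 'v \<Rightarrow> real) \<Rightarrow> ('u \<Rightarrow> nat) \<Rightarrow>
   ('v \<Rightarrow> nat) \<Rightarrow> ('v \<Rightarrow> real \<Rightarrow> real) \<Rightarrow> ('v \<Rightarrow> real) \<Rightarrow> real" where
  "fluid_opt U V E w c n p x =
     (SUP z \<in> feasible_fractional U V E c (\<lambda>v. mean_demand n p v (x v)). matching_value E w x z)"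

text \<open>
  \<^term>\<open>poisson_pmf r\<close> is only specified for \<^term>\<open>0 < r\<close>; the Poisson distribution with mean
  \<^term>\<open>0\<close>, which occurs here, is the point mass at \<^term>\<open>0\<close>.
\<close>

definition poisson0_pmf :: "real \<Rightarrow> nat pmf" where
  "poisson0_pmf r = (if r = 0 then return_pmf 0 else poisson_pmf r)"

datatype demand_model = Binomial_Demand | Poisson_Demand

fun demand_pmf ::
  "demand_model \<Rightarrow> ('v \<Rightarrow> nat) \<Rightarrow> ('v \<Rightarrow> real \<Rightarrow> real) \<Rightarrow> ('v \<Rightarrow> real) \<Rightarrow> 'v \<Rightarrow> nat pmf" where
  "demand_pmf Binomial_Demand n p x v = binomial_pmf (n v) (p v (x v))"
| "demand_pmf Poisson_Demand n p x v = poisson0_pmf (real (n v) * p v (x v))"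

definition demand_distribution ::
  "demand_model \<Rightarrow> 'v set \<Rightarrow> ('v \<Rightarrow> nat) \<Rightarrow> ('v \<Rightarrow> real \<Rightarrow> real) \<Rightarrow> ('v \<Rightarrow> real) \<Rightarrow> ('v \<Rightarrow> nat) pmf"
  where "demand_distribution m V n p x = Pi_pmf V 0 (demand_pmf m n p x)"

lemma feasible_b_matchings_nonempty: "feasible_b_matchings U V E c \<xi> \<noteq> {}"
proof -
  have "(\<lambda>_. 0) \<in> feasible_b_matchings U V E c \<xi>"
    by (simp add: feasible_b_matchings_def)
  then show ?thesis by blast
qed

lemma feasible_fractional_nonempty:
  assumes "\<And>v. v \<in> V \<Longrightarrow> 0 \<le> b v"
  shows "feasible_fractional U V E c b \<noteq> {}"
proof -
  have "(\<lambda>_. 0) \<in> feasible_fractional U V E c b"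
    using assms by (simp add: feasible_fractional_def)
  then show ?thesis by blast
qed

lemma matching_value_le:
  assumes "bipartite_graph U V E" and "z \<in> feasible_fractional U V E c b"
  shows "matching_value E w x z \<le> (\<Sum>e\<in>E. \<bar>w e + x (snd e)\<bar> * real (c (fst e)))"
  unfolding matching_value_def
proof (rule sum_mono)
  fix e assume e: "e \<in> E"
  have fin: "finite E"
    using assms(1) unfolding bipartite_graph_def by (meson finite_SigmaI finite_subset)
  have u: "fst e \<in> U"
    using e assms(1) by (auto simp: bipartite_graph_def)
  have nonneg: "0 \<le> z e'" if "e' \<in> E" for e'
    using assms(2) that by (simp add: feasible_fractional_def)
  have "z e \<le> (\<Sum>e'\<in>edges_at_left E (fst e). z e')"
    by (rule member_le_sum) (use e fin nonneg in \<open>auto simp: edges_at_left_def\<close>)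
  also have "\<dots> \<le> real (c (fst e))"
    using assms(2) u by (simp add: feasible_fractional_def)
  finally have "z e \<le> real (c (fst e))" .
  then have "\<bar>w e + x (snd e)\<bar> * z e \<le> \<bar>w e + x (snd e)\<bar> * real (c (fst e))"
    by (simp add: mult_left_mono)
  moreover have "(w e + x (snd e)) * z e \<le> \<bar>w e + x (snd e)\<bar> * z e"
    using nonneg[OF e] by (simp add: mult_right_mono)
  ultimately show "(w e + x (snd e)) * z e \<le> \<bar>w e + x (snd e)\<bar> * real (c (fst e))"
    by linarith
qed

lemma feasible_b_matchings_imp_fractional:
  assumes "z \<in> feasible_b_matchings U V E c \<xi>"
  shows "(\<lambda>e. real (z e)) \<in> feasible_fractional U V E c (\<lambda>v. real (\<xi> v))"
  using assms unfolding feasible_b_matchings_def feasible_fractional_def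
  by (simp flip: of_nat_sum)

lemma bdd_above_fractional:
  assumes "bipartite_graph U V E"
  shows "bdd_above (matching_value E w x ` feasible_fractional U V E c b)"
  using matching_value_le[OF assms] by (meson bdd_aboveI2)

lemma bdd_above_b_matchings:
  assumes "bipartite_graph U V E"
  shows "bdd_above ((\<lambda>z. matching_value E w x (\<lambda>e. real (z e))) ` feasible_b_matchings U V E c \<xi>)"
  using matching_value_le[OF assms feasible_b_matchings_imp_fractional] by (meson bdd_aboveI2)

text \<open>Boundedness uniformly in the demands makes the expectation an integral of an integrable function.\<close>

lemma integrable_b_matching_opt:
  assumes "bipartite_graph U V E"
  shows "integrable (measure_pmf D) (b_matching_opt U V E w c x)"
proof -
  let ?B = "\<Sum>e\<in>E. \<bar>w e + x (snd e)\<bar> * real (c (fst e))"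
  have upper: "b_matching_opt U V E w c x \<xi> \<le> ?B" for \<xi>
    unfolding b_matching_opt_def
    by (rule cSUP_least[OF feasible_b_matchings_nonempty])
       (rule matching_value_le[OF assms feasible_b_matchings_imp_fractional])
  have lower: "0 \<le> b_matching_opt U V E w c x \<xi>" for \<xi>
    unfolding b_matching_opt_def
    by (rule cSUP_upper2[OF bdd_above_b_matchings[OF assms], of "\<lambda>_. 0"])
       (simp_all add: feasible_b_matchings_def matching_value_def)
  show ?thesis
    by (rule measure_pmf.integrable_const_bound[where B = ?B])
       (use upper lower in \<open>auto intro!: AE_I2\<close>)
qed

end

theory Submission
  imports Defs
begin

text \<open>
  The upper bound is an averaging argument: choose an almost optimal matching for every demand
  vector \<open>\<xi>\<close>. The expected matching satisfies every capacity constraint of the fluid problem, because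
  the constraints are linear and the mean of \<open>\<xi> v\<close> is the fluid capacity of \<open>v\<close>; its value is the
  expected value of the matchings chosen. This is \<open>expected_b_matching_opt_le\<close>.

  The lower bound rounds a feasible fractional solution \<open>z\<close> by random routing. Split every left node
  \<open>u\<close> into \<open>c u\<close> unit-capacity slots \<open>(u, j)\<close>. Let \<open>b v\<close> be the mean demand at \<open>v\<close>, and send each of
  the \<open>\<xi> v\<close> arrivals at \<open>v\<close>, independently, to slot \<open>(u, j)\<close> with probability at least
  \<open>z (u, v) / (c u * b v)\<close>; the constraint at \<open>v\<close> makes these numbers sum to at most \<open>1\<close>
  (\<open>exists_routing\<close>). Every slot keeps the best positive offer that it receives. For each outcome of
  the routing this is a feasible matching, so it is worth at most the optimum for the demands \<open>\<xi>\<close>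
  (\<open>sum_best_offer_le_b_matching_opt\<close>).

  The slot receives nothing from \<open>v\<close> with probability at most \<open>exp (- y v)\<close>, where
  \<open>y v = z (u, v) / c u\<close>: for both demand models this is an estimate of the probability generating
  function (\<open>demand_pmf_thinned_zero\<close>). By independence, an offer from some \<open>v\<close> in a set \<open>W\<close> of
  neighbours of \<open>u\<close> arrives with probability at least \<open>1 - exp (- sum y W)\<close>, and since \<open>sum y W \<le> 1\<close> by
  the constraint at \<open>u\<close>, concavity bounds this below by \<open>(1 - 1 / exp 1) * sum y W\<close>
  (\<open>prob_some_offer_ge\<close>). Writing the value of the best offer as a combination, with non-negative
  coefficients, of indicators that some offer of at least a given value is present turns this into
  \<open>(1 - 1 / exp 1)\<close> times the share of \<open>z\<close> that belongs to the slot (\<open>expectation_best_ge\<close>). Summation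
  over the slots gives the bound.
\<close>

section \<open>The demand distributions\<close>

lemma nat_pmf_expectation_sums:
  fixes M :: "nat pmf" and f :: "nat \<Rightarrow> real"
  assumes "\<And>k. 0 \<le> f k" and "(\<lambda>k. pmf M k * f k) sums S"
  shows "integrable (measure_pmf M) f" and "measure_pmf.expectation M f = S"
proof -
  have int: "integrable (count_space UNIV) (\<lambda>k. pmf M k * f k)"
    using assms by (auto simp: integrable_count_space_nat_iff abs_mult sums_iff)
  show "integrable (measure_pmf M) f"
    unfolding measure_pmf_eq_density by (subst integrable_density) (use int in auto)
  have "measure_pmf.expectation M f = (\<integral>k. pmf M k * f k \<partial>count_space UNIV)"
    unfolding measure_pmf_eq_density by (subst integral_density) auto
  also have "\<dots> = S"
    using int assms(2) by (simp add: integral_count_space_nat sums_iff)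
  finally show "measure_pmf.expectation M f = S" .
qed

lemma expectation_binomial_power:
  fixes p y :: real
  assumes "p \<in> {0..1}"
  shows "measure_pmf.expectation (binomial_pmf n p) (\<lambda>k. y ^ k) = (1 - p + p * y) ^ n"
proof -
  have "measure_pmf.expectation (binomial_pmf n p) (\<lambda>k. y ^ k)
      = (\<Sum>k\<le>n. real (n choose k) * (p * y) ^ k * (1 - p) ^ (n - k))"
    using assms by (simp add: expectation_binomial_pmf' power_mult_distrib mult_ac)
  also have "\<dots> = (p * y + (1 - p)) ^ n"
    by (simp add: binomial_ring)
  finally show ?thesis by (simp add: add_ac)
qed

lemma expectation_binomial:
  assumes "p \<in> {0..1}"
  shows "measure_pmf.expectation (binomial_pmf n p) real = real n * p"
proof -
  have "measure_pmf.expectation (binomial_pmf n p) real = (\<Sum>k\<le>n. real k * Bernstein n k p)"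
    using assms by (simp add: expectation_binomial_pmf' Bernstein_def mult_ac)
  then show ?thesis by simp
qed

lemma expectation_poisson_power:
  fixes r y :: real
  assumes "0 < r" and "0 \<le> y"
  shows "measure_pmf.expectation (poisson_pmf r) (\<lambda>k. y ^ k) = exp (- (r * (1 - y)))"
proof (rule nat_pmf_expectation_sums(2))
  have "(\<lambda>k. exp (- r) * ((r * y) ^ k /\<^sub>R fact k)) sums (exp (- r) * exp (r * y))"
    by (intro sums_mult exp_converges)
  also have "exp (- r) * exp (r * y) = exp (- (r * (1 - y)))"
    by (simp add: algebra_simps flip: exp_add)
  finally show "(\<lambda>k. pmf (poisson_pmf r) k * y ^ k) sums exp (- (r * (1 - y)))"
    using assms by (simp add: field_simps power_mult_distrib)
qed (use assms in simp)

lemma expectation_poisson: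
  assumes "0 < r"
  shows "integrable (measure_pmf (poisson_pmf r)) real"
    and "measure_pmf.expectation (poisson_pmf r) real = r"
proof -
  (* The term at 0 of the series for the mean vanishes; the others are r times those for the total mass. *)
  have shift: "pmf (poisson_pmf r) (Suc k) * real (Suc k) = r * exp (- r) * (r ^ k /\<^sub>R fact k)" for k
    using assms by (simp add: divide_simps del: of_nat_Suc)
  have "(\<lambda>k. r * exp (- r) * (r ^ k /\<^sub>R fact k)) sums (r * exp (- r) * exp r)"
    by (intro sums_mult exp_converges)
  then have "(\<lambda>k. pmf (poisson_pmf r) (Suc k) * real (Suc k)) sums r"
    unfolding shift by (simp add: mult.assoc flip: exp_add)
  then have "(\<lambda>k. pmf (poisson_pmf r) k * real k) sums r"
    by (subst (asm) sums_Suc_iff) simp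
  then show "integrable (measure_pmf (poisson_pmf r)) real"
    and "measure_pmf.expectation (poisson_pmf r) real = r"
    using nat_pmf_expectation_sums[of real "poisson_pmf r" r] by auto
qed

lemma demand_pmf_mean:
  assumes "p v (x v) \<in> {0..1}"
  shows "integrable (measure_pmf (demand_pmf m n p x v)) real"
    and "measure_pmf.expectation (demand_pmf m n p x v) real = mean_demand n p v (x v)"
proof -
  have nonneg: "0 \<le> real (n v) * p v (x v)"
    using assms by simp
  have "integrable (measure_pmf (demand_pmf m n p x v)) real \<and>
        measure_pmf.expectation (demand_pmf m n p x v) real = mean_demand n p v (x v)"
  proof (cases m)
    case Binomial_Demand
    then show ?thesis
      using assms by (simp add: expectation_binomial mean_demand_def)
  next
    case Poisson_Demand
    then show ?thesis
      using nonneg expectation_poisson[of "real (n v) * p v (x v)"]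
      by (cases "real (n v) * p v (x v) = 0")
        (auto simp: poisson0_pmf_def mean_demand_def integrable_measure_pmf_finite)
  qed
  then show "integrable (measure_pmf (demand_pmf m n p x v)) real"
    and "measure_pmf.expectation (demand_pmf m n p x v) real = mean_demand n p v (x v)"
    by auto
qed

text \<open>
  If each of the \<open>k\<close> arrivals is selected independently with probability \<open>q\<close>, then \<open>(1 - q) ^ k\<close> is
  the probability that none is. For Poisson demand equality holds; for binomial demand the exact value
  is \<open>(1 - a) ^ n v\<close> with \<open>a = p v (x v) * q\<close>, and \<open>1 - a \<le> exp (- a)\<close>. This bound and the mean are all
  that the argument uses about the two models.
\<close>

lemma demand_pmf_thinned_zero:
  assumes "p v (x v) \<in> {0..1}" and "q \<in> {0..1}"
  shows "measure_pmf.expectation (demand_pmf m n p x v) (\<lambda>k. (1 - q) ^ k)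
       \<le> exp (- (mean_demand n p v (x v) * q))"
proof (cases m)
  case Binomial_Demand
  let ?a = "p v (x v) * q"
  have "0 \<le> 1 - ?a"
    using assms by (simp add: mult_le_one)
  then have "(1 - ?a) ^ n v \<le> exp (- ?a) ^ n v"
    using exp_ge_add_one_self[of "- ?a"] by (intro power_mono) auto
  also have "\<dots> = exp (- (mean_demand n p v (x v) * q))"
    by (simp add: mean_demand_def mult.assoc flip: exp_of_nat_mult)
  finally show ?thesis
    using assms Binomial_Demand by (simp add: expectation_binomial_power algebra_simps)
next
  case Poisson_Demand
  have "0 \<le> real (n v) * p v (x v)"
    using assms by simp
  then show ?thesis
    using Poisson_Demand assms expectation_poisson_power[of "real (n v) * p v (x v)" "1 - q"]
    by (auto simp: poisson0_pmf_def mean_demand_def)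
qed

section \<open>Random routing of arrivals\<close>

lemma measure_bind_pmf:
  "measure_pmf.prob (bind_pmf M N) X = measure_pmf.expectation M (\<lambda>a. measure_pmf.prob (N a) X)"
  unfolding measure_pmf_bind
  by (rule measure_pmf.measure_bind[where N = "count_space UNIV"]) (auto simp: measure_subprob)

text \<open>
  A subprobability on a finite set extends to a probability by placing the missing mass on an arbitrary
  point. Only lower bounds on the routing probabilities matter, since additional arrivals at a slot can
  only improve its best offer, so it is harmless if that point belongs to \<open>S\<close>.
\<close>

lemma exists_pmf_above:
  fixes g :: "'a \<Rightarrow> real"
  assumes "finite S" and "\<And>s. s \<in> S \<Longrightarrow> 0 \<le> g s" and "sum g S \<le> 1"
  shows "\<exists>\<rho>. \<forall>s\<in>S. g s \<le> pmf \<rho> s"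
proof -
  define s\<^sub>0 :: 'a where "s\<^sub>0 = undefined"
  define h where "h s = (if s \<in> S then g s else 0) + (if s = s\<^sub>0 then 1 - sum g S else 0)" for s
  have nonneg: "0 \<le> h s" for s
    using assms by (auto simp: h_def)
  have "(\<integral>\<^sup>+ s. ennreal (h s) \<partial>count_space UNIV) = (\<Sum>s\<in>insert s\<^sub>0 S. ennreal (h s))"
    by (rule nn_integral_count_space'[OF _ _ subset_UNIV])
       (use assms(1) in \<open>auto simp: h_def\<close>)
  also have "\<dots> = ennreal (\<Sum>s\<in>insert s\<^sub>0 S. h s)"
    by (rule sum_ennreal) (rule nonneg)
  also have "(\<Sum>s\<in>insert s\<^sub>0 S. h s) = 1"
  proof -
    have "(\<Sum>s\<in>insert s\<^sub>0 S. if s \<in> S then g s else 0) = sum g S"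
      using assms(1) by (intro sum.mono_neutral_cong_right) auto
    then show ?thesis
      using assms(1) by (simp add: h_def sum.distrib del: sum.insert)
  qed
  finally have total: "(\<integral>\<^sup>+ s. ennreal (h s) \<partial>count_space UNIV) = 1" by simp
  have "g s \<le> pmf (embed_pmf h) s" if "s \<in> S" for s
    using that assms(3) by (simp add: pmf_embed_pmf[OF nonneg total] h_def)
  then show ?thesis by blast
qed

text \<open>
  The destinations of the arrivals at one node are kept as a list, so that its length recovers the
  demand while its set of elements tells which slots receive an offer.
\<close>

definition routed_arrivals :: "nat pmf \<Rightarrow> 's pmf \<Rightarrow> 's list pmf" where
  "routed_arrivals D \<rho> = bind_pmf D (\<lambda>k. replicate_pmf k \<rho>)"

lemma map_length_routed_arrivals: "map_pmf length (routed_arrivals D \<rho>) = D"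
proof -
  have "map_pmf length (replicate_pmf k \<rho>) = return_pmf k" for k
  proof -
    have "map_pmf length (replicate_pmf k \<rho>) = map_pmf (\<lambda>_. k) (replicate_pmf k \<rho>)"
      by (rule map_pmf_cong) (auto simp: set_replicate_pmf)
    then show ?thesis by (simp add: map_pmf_const)
  qed
  then show ?thesis
    by (simp add: routed_arrivals_def map_bind_pmf bind_return_pmf')
qed

lemma prob_replicate_pmf_avoids:
  "measure_pmf.prob (replicate_pmf k \<rho>) {l. s \<notin> set l} = (1 - pmf \<rho> s) ^ k"
proof (induction k)
  case (Suc k)
  have step: "measure_pmf.prob (replicate_pmf k \<rho> \<bind> (\<lambda>l. return_pmf (a # l))) {l. s \<notin> set l}
      = (1 - pmf \<rho> s) ^ k * indicator (- {s}) a" for a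
    using Suc by (cases "a = s")
      (auto simp: vimage_def simp flip: map_pmf_def split: split_indicator)
  have "measure_pmf.prob \<rho> (- {s}) = 1 - pmf \<rho> s"
    using measure_pmf.prob_compl[of "{s}" \<rho>] by (simp add: Compl_eq_Diff_UNIV measure_pmf_single)
  then show ?case
    by (simp add: measure_bind_pmf[of \<rho>] step)
qed simp

lemma prob_routed_arrivals_avoids:
  "measure_pmf.prob (routed_arrivals D \<rho>) {l. s \<notin> set l}
     = measure_pmf.expectation D (\<lambda>k. (1 - pmf \<rho> s) ^ k)"
  by (simp add: routed_arrivals_def measure_bind_pmf prob_replicate_pmf_avoids)

section \<open>The best element of a random set\<close>

lemma one_minus_exp_neg_ge_linear:
  fixes y :: real
  assumes "y \<in> {0..1}"
  shows "(1 - 1 / exp 1) * y \<le> 1 - exp (- y)"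
proof -
  have "exp ((1 - y) *\<^sub>R 0 + y *\<^sub>R (- 1)) \<le> (1 - y) * exp 0 + y * exp (- 1 :: real)"
    by (rule convex_onD[OF exp_convex]) (use assms in auto)
  then show ?thesis
    by (simp add: exp_minus field_simps)
qed

text \<open>
  If every subset \<open>B'\<close> of \<open>B\<close> is hit by the random set \<open>A\<close> with probability at least \<open>\<kappa> * sum y B'\<close>,
  then the best weight found in \<open>A\<close> is worth at least the \<open>\<kappa>\<close>-fraction of the \<open>y\<close>-weighted sum of the
  weights. Here \<open>F\<close> is any non-negative upper bound of that best weight, a property that is
  preserved when the proof peels off the least weight \<open>r b\<^sub>0\<close>: whenever \<open>A\<close> hits \<open>B\<close> at all, \<open>F\<close> collects
  \<open>r b\<^sub>0\<close>, and what remains of \<open>F\<close> dominates the weights \<open>r b - r b\<^sub>0\<close> on \<open>B - {b\<^sub>0}\<close>, to which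
  the induction hypothesis applies.
\<close>

lemma expectation_best_ge:
  fixes M :: "'a pmf" and r y :: "'b \<Rightarrow> real" and F :: "'a \<Rightarrow> real"
  assumes "finite B"
    and "\<And>B'. B' \<subseteq> B \<Longrightarrow> \<kappa> * sum y B' \<le> measure_pmf.prob M {\<omega>. A \<omega> \<inter> B' \<noteq> {}}"
    and "\<And>b. b \<in> B \<Longrightarrow> 0 \<le> r b"
    and "integrable (measure_pmf M) F"
    and "\<And>\<omega>. 0 \<le> F \<omega>"
    and "\<And>\<omega> b. b \<in> B \<Longrightarrow> b \<in> A \<omega> \<Longrightarrow> r b \<le> F \<omega>"
  shows "\<kappa> * (\<Sum>b\<in>B. r b * y b) \<le> measure_pmf.expectation M F"
  using assms
proof (induction B arbitrary: r F rule: finite_psubset_induct)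
  case (psubset B)
  show ?case
  proof (cases "B = {}")
    case True
    then show ?thesis using psubset.prems(4) by simp
  next
    case False
    define b\<^sub>0 where "b\<^sub>0 = arg_min_on r B"
    have b\<^sub>0: "b\<^sub>0 \<in> B"
      unfolding b\<^sub>0_def using False psubset.hyps by (intro arg_min_if_finite)
    have least: "r b\<^sub>0 \<le> r b" if "b \<in> B" for b
      unfolding b\<^sub>0_def using that False psubset.hyps by (intro arg_min_least)
    let ?hit = "{\<omega>. A \<omega> \<inter> B \<noteq> {}}"
    define G where "G \<omega> = F \<omega> - r b\<^sub>0 * indicator ?hit \<omega>" for \<omega>
    have int_G: "integrable (measure_pmf M) G"
      unfolding G_def using psubset.prems(3)
      by (intro Bochner_Integration.integrable_diff integrable_mult_right) (auto simp: measure_pmf.emeasure_eq_measure)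
    have "\<kappa> * (\<Sum>b\<in>B - {b\<^sub>0}. (r b - r b\<^sub>0) * y b) \<le> measure_pmf.expectation M G"
    proof (rule psubset.IH)
      show "0 \<le> G \<omega>" for \<omega>
        using psubset.prems(4,5) least unfolding G_def
        by (force split: split_indicator intro: order_trans)
      show "r b - r b\<^sub>0 \<le> G \<omega>" if "b \<in> B - {b\<^sub>0}" "b \<in> A \<omega>" for b \<omega>
      proof -
        have "\<omega> \<in> ?hit" and "r b \<le> F \<omega>"
          using that psubset.prems(5) by auto
        then show ?thesis by (simp add: G_def)
      qed
    qed (use b\<^sub>0 least int_G psubset.prems(1) in auto)
    moreover have "r b\<^sub>0 * (\<kappa> * sum y B) \<le> r b\<^sub>0 * measure_pmf.prob M ?hit"
      using psubset.prems(1,2) b\<^sub>0 by (intro mult_left_mono) auto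
    moreover have "measure_pmf.expectation M G
        = measure_pmf.expectation M F - r b\<^sub>0 * measure_pmf.prob M ?hit"
      unfolding G_def using psubset.prems(3)
      by (subst Bochner_Integration.integral_diff)
        (auto simp: measure_pmf.emeasure_eq_measure)
    moreover have "(\<Sum>b\<in>B. r b * y b)
        = (\<Sum>b\<in>B - {b\<^sub>0}. (r b - r b\<^sub>0) * y b) + r b\<^sub>0 * sum y B"
      using psubset.hyps b\<^sub>0
      by (simp add: sum.remove[of B b\<^sub>0] algebra_simps sum_distrib_left sum_subtractf)
    ultimately show ?thesis
      by (simp add: algebra_simps)
  qed
qed

section \<open>Matching by slots\<close>

lemma finite_edges: "bipartite_graph U V E \<Longrightarrow> finite E"
  unfolding bipartite_graph_def by (meson finite_SigmaI finite_subset)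

text \<open>
  The \<open>0\<close> among the candidates is the option to leave the slot unmatched; it discards edges of negative
  weight.
\<close>

definition best_offer ::
  "('u \<times> 'v) set \<Rightarrow> ('u \<times> 'v \<Rightarrow> real) \<Rightarrow> ('v \<Rightarrow> real) \<Rightarrow> ('v \<Rightarrow> ('u \<times> nat) list) \<Rightarrow> 'u \<times> nat \<Rightarrow> real"
  where "best_offer E w x L s =
    Max (insert 0 ((\<lambda>e. w e + x (snd e)) ` {e \<in> edges_at_left E (fst s). s \<in> set (L (snd e))}))"

text \<open>
  Let \<open>z e\<close> count the slots whose best offer is made along \<open>e\<close>. Distinct slots matched to \<open>v\<close> are
  distinct elements of the list \<open>L v\<close>, so \<open>v\<close> is used at most \<open>length (L v)\<close> times, and \<open>u\<close> is used at
  most once per slot; hence \<open>z\<close> is a feasible matching, and its value is the sum of the best offers.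
\<close>

lemma sum_best_offer_le_b_matching_opt:
  assumes G: "bipartite_graph U V E"
  shows "(\<Sum>s\<in>(SIGMA u:U. {..<c u}). best_offer E w x L s)
       \<le> b_matching_opt U V E w c x (\<lambda>v. length (L v))"
proof -
  let ?S = "SIGMA u:U. {..<c u}"
  have finE: "finite E" using G by (rule finite_edges)
  have finS: "finite ?S" using G by (auto simp: bipartite_graph_def)
  have "\<exists>ch. (\<forall>e. ch = Some e \<longrightarrow> e \<in> edges_at_left E (fst s) \<and> s \<in> set (L (snd e))) \<and>
             best_offer E w x L s = (case ch of None \<Rightarrow> 0 | Some e \<Rightarrow> w e + x (snd e))" for s
  proof -
    let ?O = "{e \<in> edges_at_left E (fst s). s \<in> set (L (snd e))}"
    have "finite ?O"
      using finE by (auto simp: edges_at_left_def)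
    then have "best_offer E w x L s \<in> insert 0 ((\<lambda>e. w e + x (snd e)) ` ?O)"
      unfolding best_offer_def by (intro Max_in) auto
    then consider "best_offer E w x L s = 0"
      | e where "e \<in> ?O" "best_offer E w x L s = w e + x (snd e)" by blast
    then show ?thesis
    proof cases
      case 1
      then show ?thesis by (intro exI[of _ None]) simp
    next
      case (2 e)
      then show ?thesis by (intro exI[of _ "Some e"]) simp
    qed
  qed
  then obtain ch where
    ch: "ch s = Some e \<Longrightarrow> e \<in> edges_at_left E (fst s) \<and> s \<in> set (L (snd e))" and
    best: "best_offer E w x L s = (case ch s of None \<Rightarrow> 0 | Some e \<Rightarrow> w e + x (snd e))" for s e
    by metis
  define z where "z e = card {s \<in> ?S. ch s = Some e}" for e
  (* A slot chooses at most one edge, so the sets of slots counted by z are disjoint. *)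
  have sum_z: "(\<Sum>e\<in>B. z e) \<le> card T"
    if "B \<subseteq> E" "finite T" "\<And>s e. s \<in> ?S \<Longrightarrow> e \<in> B \<Longrightarrow> ch s = Some e \<Longrightarrow> s \<in> T" for B T
  proof -
    have "(\<Sum>e\<in>B. z e) = card (\<Union>e\<in>B. {s \<in> ?S. ch s = Some e})"
      unfolding z_def using that(1) finE finS
      by (intro card_UN_disjoint[symmetric]) (auto intro: finite_subset)
    also have "\<dots> \<le> card T"
      using that by (intro card_mono) auto
    finally show ?thesis .
  qed
  have "z \<in> feasible_b_matchings U V E c (\<lambda>v. length (L v))"
    unfolding feasible_b_matchings_def
  proof (safe)
    fix v assume "v \<in> V"
    have "(\<Sum>e\<in>edges_at_right E v. z e) \<le> card (set (L v))"
      by (rule sum_z) (use ch in \<open>auto simp: edges_at_right_def\<close>)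
    then show "(\<Sum>e\<in>edges_at_right E v. z e) \<le> length (L v)"
      using card_length le_trans by blast
  next
    fix u assume "u \<in> U"
    have "(\<Sum>e\<in>edges_at_left E u. z e) \<le> card ({u} \<times> {..<c u})"
      by (rule sum_z) (use ch in \<open>force simp: edges_at_left_def\<close>)+
    then show "(\<Sum>e\<in>edges_at_left E u. z e) \<le> c u"
      by (simp add: card_cartesian_product)
  qed
  moreover have "matching_value E w x (\<lambda>e. real (z e)) = (\<Sum>s\<in>?S. best_offer E w x L s)"
  proof -
    have "matching_value E w x (\<lambda>e. real (z e))
        = (\<Sum>e\<in>E. \<Sum>s\<in>?S. if ch s = Some e then w e + x (snd e) else 0)"
      unfolding matching_value_def z_def using finS
      by (intro sum.cong refl) (simp add: sum.If_cases Int_def)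
    also have "\<dots> = (\<Sum>s\<in>?S. \<Sum>e\<in>E. if ch s = Some e then w e + x (snd e) else 0)"
      by (rule sum.swap)
    also have "\<dots> = (\<Sum>s\<in>?S. best_offer E w x L s)"
    proof (rule sum.cong[OF refl])
      fix s
      show "(\<Sum>e\<in>E. if ch s = Some e then w e + x (snd e) else 0) = best_offer E w x L s"
        using finE ch[of s] best[of s] by (cases "ch s") (auto simp: edges_at_left_def)
    qed
    finally show ?thesis .
  qed
  ultimately show ?thesis
    unfolding b_matching_opt_def
    by (intro cSUP_upper2[OF bdd_above_b_matchings[OF G]]) auto
qed

lemma sum_edges_eq_sum_slots:
  assumes G: "bipartite_graph U V E" and c: "\<And>u. u \<in> U \<Longrightarrow> 0 < c u"
  shows "(\<Sum>e\<in>E. f e)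
       = (\<Sum>s\<in>(SIGMA u:U. {..<c u}). \<Sum>e\<in>edges_at_left E (fst s). f e / real (c (fst s)))"
proof -
  have fin: "finite U" "finite E" and sub: "fst ` E \<subseteq> U"
    using G finite_edges[OF G] by (auto simp: bipartite_graph_def)
  have "(\<Sum>e\<in>E. f e) = (\<Sum>u\<in>U. \<Sum>e\<in>edges_at_left E u. f e)"
    unfolding edges_at_left_def by (rule sum.group[symmetric]) (use fin sub in auto)
  also have "\<dots> = (\<Sum>u\<in>U. \<Sum>j<c u. \<Sum>e\<in>edges_at_left E u. f e / real (c u))"
    using c by (intro sum.cong) (auto simp flip: sum_divide_distrib)
  also have "\<dots> = (\<Sum>s\<in>(SIGMA u:U. {..<c u}). \<Sum>e\<in>edges_at_left E (fst s). f e / real (c (fst s)))"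
    using fin by (subst sum.Sigma) (auto intro!: sum.cong)
  finally show ?thesis .
qed

section \<open>The two bounds\<close>

text \<open>
  The lists of different nodes are independent, so the probability that all nodes of \<open>W\<close> miss the
  slot \<open>s\<close> factorizes and is at most \<open>exp (- sum y W)\<close>.
\<close>

lemma prob_some_offer_ge:
  fixes \<mu> :: "'v \<Rightarrow> 's list pmf" and y :: "'v \<Rightarrow> real"
  assumes "finite V" and "W \<subseteq> V" and "\<And>v. v \<in> W \<Longrightarrow> 0 \<le> y v" and "sum y W \<le> 1"
    and "\<And>v. v \<in> W \<Longrightarrow> measure_pmf.prob (\<mu> v) {l. s \<notin> set l} \<le> exp (- y v)"
  shows "(1 - 1 / exp 1) * sum y W
       \<le> measure_pmf.prob (Pi_pmf V [] \<mu>) {L. \<exists>v\<in>W. s \<in> set (L v)}"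
proof -
  let ?P = "Pi_pmf V [] \<mu>"
  have finW: "finite W" using assms(1,2) by (rule finite_subset[rotated])
  have "{L. \<forall>v\<in>W. s \<notin> set (L v)} = Pi V (\<lambda>v. if v \<in> W then {l. s \<notin> set l} else UNIV)"
    using assms(2) by (auto simp: Pi_def)
  then have "measure_pmf.prob ?P {L. \<forall>v\<in>W. s \<notin> set (L v)}
      = (\<Prod>v\<in>V. measure_pmf.prob (\<mu> v) (if v \<in> W then {l. s \<notin> set l} else UNIV))"
    using assms(1) by (simp add: measure_Pi_pmf_Pi)
  also have "\<dots> = (\<Prod>v\<in>W. measure_pmf.prob (\<mu> v) {l. s \<notin> set l})"
    using assms(1,2) by (intro prod.mono_neutral_cong_right) auto
  also have "\<dots> \<le> (\<Prod>v\<in>W. exp (- y v))"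
    using assms(5) by (intro prod_mono) auto
  also have "\<dots> = exp (- sum y W)"
    using finW by (simp add: exp_sum sum_negf flip: exp_sum)
  finally have "measure_pmf.prob ?P {L. \<forall>v\<in>W. s \<notin> set (L v)} \<le> exp (- sum y W)" .
  moreover have "{L. \<exists>v\<in>W. s \<in> set (L v)} = UNIV - {L. \<forall>v\<in>W. s \<notin> set (L v)}"
    by auto
  then have "measure_pmf.prob ?P {L. \<exists>v\<in>W. s \<in> set (L v)}
      = 1 - measure_pmf.prob ?P {L. \<forall>v\<in>W. s \<notin> set (L v)}"
    using measure_pmf.prob_compl[of "{L. \<forall>v\<in>W. s \<notin> set (L v)}" ?P] by simp
  moreover have "(1 - 1 / exp 1) * sum y W \<le> 1 - exp (- sum y W)"
    using assms(3,4) by (intro one_minus_exp_neg_ge_linear) (auto intro: sum_nonneg)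
  ultimately show ?thesis by linarith
qed

text \<open>
  Summed over the \<open>c u\<close> slots of each neighbour \<open>u\<close>, the prescribed probabilities add up to
  \<open>(\<Sum>u. z (u, v)) / b v\<close>, which is at most \<open>1\<close> by the constraint at \<open>v\<close>. If \<open>b v = 0\<close>, they are all
  \<open>0\<close> because division by zero yields zero.
\<close>

lemma exists_routing:
  assumes G: "bipartite_graph U V E" and c: "\<And>u. u \<in> U \<Longrightarrow> 0 < c u"
    and z: "z \<in> feasible_fractional U V E c b" and v: "v \<in> V"
  shows "\<exists>\<rho>. \<forall>u j. (u, v) \<in> E \<longrightarrow> j < c u \<longrightarrow> z (u, v) / (real (c u) * b v) \<le> pmf \<rho> (u, j)"
proof -
  let ?N = "fst ` edges_at_right E v"
  let ?g = "\<lambda>(u, j :: nat). z (u, v) / (real (c u) * b v)"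
  have finN: "finite ?N"
    using finite_edges[OF G] by (auto simp: edges_at_right_def)
  have z_nonneg: "0 \<le> z e" if "e \<in> E" for e
    using z that by (simp add: feasible_fractional_def)
  have cap: "(\<Sum>e\<in>edges_at_right E v. z e) \<le> b v"
    using z v by (simp add: feasible_fractional_def)
  have b_nonneg: "0 \<le> b v"
    using cap sum_nonneg[of "edges_at_right E v" z] z_nonneg by (force simp: edges_at_right_def)
  have "(\<Sum>s\<in>(SIGMA u:?N. {..<c u}). ?g s) = (\<Sum>u\<in>?N. \<Sum>j<c u. z (u, v) / (real (c u) * b v))"
    using finN by (subst sum.Sigma) auto
  also have "\<dots> = (\<Sum>u\<in>?N. z (u, v) / b v)"
    using G by (intro sum.cong) (auto simp: edges_at_right_def bipartite_graph_def dest!: c)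
  also have "\<dots> = (\<Sum>e\<in>edges_at_right E v. z e) / b v"
    by (subst sum.reindex) (auto simp: inj_on_def edges_at_right_def sum_divide_distrib intro!: sum.cong)
  also have "\<dots> \<le> 1"
    using cap b_nonneg by (auto simp: divide_le_eq_1)
  finally have "\<exists>\<rho>. \<forall>s\<in>(SIGMA u:?N. {..<c u}). ?g s \<le> pmf \<rho> s"
    using finN z_nonneg b_nonneg
    by (intro exists_pmf_above) (auto simp: edges_at_right_def)
  then show ?thesis
    by (force simp: edges_at_right_def)
qed

text \<open>
  The rounding argument, for any independent demands that satisfy the generating function estimate.
  The expectation over demands is rewritten as one over routed arrivals, whose lengths are distributed
  like the demands.
\<close>

lemma fractional_le_expected_b_matching_opt:
  fixes D :: "'v \<Rightarrow> nat pmf"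
  assumes G: "bipartite_graph U V E" and c: "\<And>u. u \<in> U \<Longrightarrow> 0 < c u"
    and z: "z \<in> feasible_fractional U V E c b"
    and thin: "\<And>v q. v \<in> V \<Longrightarrow> q \<in> {0..1} \<Longrightarrow>
      measure_pmf.expectation (D v) (\<lambda>k. (1 - q) ^ k) \<le> exp (- (b v * q))"
  shows "(1 - 1 / exp 1) * matching_value E w x z
       \<le> measure_pmf.expectation (Pi_pmf V 0 D) (b_matching_opt U V E w c x)"
proof -
  let ?\<kappa> = "1 - 1 / exp 1 :: real" and ?S = "SIGMA u:U. {..<c u}"
  have fin: "finite V" "finite E" "finite ?S"
    using G finite_edges[OF G] by (auto simp: bipartite_graph_def)
  have edge: "u \<in> U" "v \<in> V" if "(u, v) \<in> E" for u v
    using G that by (auto simp: bipartite_graph_def)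
  have z_nonneg: "0 \<le> z e" if "e \<in> E" for e
    using z that by (simp add: feasible_fractional_def)
  obtain \<rho> where \<rho>: "v \<in> V \<Longrightarrow> (u, v) \<in> E \<Longrightarrow> j < c u \<Longrightarrow>
      z (u, v) / (real (c u) * b v) \<le> pmf (\<rho> v) (u, j)" for u v j
    using exists_routing[OF G c z] by metis
  define \<mu> where "\<mu> v = routed_arrivals (D v) (\<rho> v)" for v
  define P where "P = Pi_pmf V [] \<mu>"
  define r where "r e = max 0 (w e + x (snd e))" for e
  let ?F = "\<lambda>s L. best_offer E w x L s"
  have finO: "finite {e \<in> edges_at_left E (fst s). s \<in> set (L (snd e))}" for s and L :: "'v \<Rightarrow> ('a \<times> nat) list"
    using fin by (auto simp: edges_at_left_def)
  have F_ge: "r e \<le> ?F s L" if "e \<in> edges_at_left E (fst s)" "s \<in> set (L (snd e))" for s L e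
    unfolding best_offer_def r_def using that finO[of s L] by (auto intro!: Max_ge)
  have F_nonneg: "0 \<le> ?F s L" for s L
    unfolding best_offer_def using finO[of s L] by (auto intro!: Max_ge)
  have F_le: "?F s L \<le> (\<Sum>e\<in>E. r e)" for s L
    unfolding best_offer_def using finO[of s L] fin
    by (auto simp: edges_at_left_def r_def intro!: sum_nonneg order_trans[OF _ member_le_sum[of _ E]])
  have F_int: "integrable (measure_pmf P) (?F s)" for s
    by (rule measure_pmf.integrable_const_bound[where B = "\<Sum>e\<in>E. r e"])
       (use F_nonneg F_le in \<open>auto intro!: AE_I2\<close>)
  have miss: "measure_pmf.prob (\<mu> v) {l. (u, j) \<notin> set l} \<le> exp (- (z (u, v) / real (c u)))"
    if e: "(u, v) \<in> E" and j: "j < c u" for u v j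
  proof -
    have "v \<in> V" using e edge by blast
    have e': "(u, v) \<in> edges_at_right E v" using e by (simp add: edges_at_right_def)
    have "z (u, v) \<le> (\<Sum>e\<in>edges_at_right E v. z e)"
      by (rule member_le_sum[OF e']) (use fin z_nonneg in \<open>auto simp: edges_at_right_def\<close>)
    also have "\<dots> \<le> b v"
      using z \<open>v \<in> V\<close> by (simp add: feasible_fractional_def)
    finally have z_le: "z (u, v) \<le> b v" .
    have "measure_pmf.prob (\<mu> v) {l. (u, j) \<notin> set l} \<le> exp (- (b v * pmf (\<rho> v) (u, j)))"
      unfolding \<mu>_def prob_routed_arrivals_avoids
      by (rule thin) (use \<open>v \<in> V\<close> in \<open>auto simp: pmf_le_1\<close>)
    moreover have "z (u, v) / real (c u) \<le> b v * pmf (\<rho> v) (u, j)"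
    proof (cases "b v = 0")
      (* A node without demand carries no fractional flow, so there is nothing to route. *)
      case True
      then show ?thesis using z_le z_nonneg[OF e] by simp
    next
      case False
      then have "0 < b v" using z_le z_nonneg[OF e] by linarith
      then show ?thesis
        using \<rho>[OF \<open>v \<in> V\<close> e j] j by (simp add: field_simps)
    qed
    ultimately show ?thesis by (simp add: order_trans)
  qed
  have slot: "?\<kappa> * (\<Sum>e\<in>edges_at_left E (fst s). r e * (z e / real (c (fst s))))
      \<le> measure_pmf.expectation P (?F s)" if s: "s \<in> ?S" for s
  proof (rule expectation_best_ge[where A = "\<lambda>L. {e. s \<in> set (L (snd e))}"])
    obtain u j where s_eq: "s = (u, j)" and u: "u \<in> U" and j: "j < c u"
      using s by auto
    fix B assume B: "B \<subseteq> edges_at_left E (fst s)"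
    let ?y = "\<lambda>v. z (u, v) / real (c u)"
    have B_edge: "e \<in> E \<and> e = (u, snd e)" if "e \<in> B" for e
      using that B s_eq by (auto simp: edges_at_left_def)
    (* The edges at u have distinct right endpoints, which makes their offers independent. *)
    have inj: "inj_on snd B"
      by (rule inj_onI) (metis B_edge)
    have sum_B: "(\<Sum>e\<in>B. z e / real (c (fst s))) = sum ?y (snd ` B)"
      unfolding sum.reindex[OF inj] using B_edge s_eq by (auto intro!: sum.cong)
    have "(\<Sum>e\<in>B. z e) \<le> (\<Sum>e\<in>edges_at_left E u. z e)"
      by (rule sum_mono2) (use B s_eq fin z_nonneg in \<open>auto simp: edges_at_left_def\<close>)
    also have "\<dots> \<le> real (c u)"
      using z u by (simp add: feasible_fractional_def)
    finally have "(\<Sum>e\<in>B. z e / real (c (fst s))) \<le> 1"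
      using j s_eq by (simp flip: sum_divide_distrib)
    then have "?\<kappa> * sum ?y (snd ` B) \<le> measure_pmf.prob P {L. \<exists>v\<in>snd ` B. s \<in> set (L v)}"
      unfolding P_def using B_edge edge miss[OF _ j] z_nonneg fin sum_B s_eq
      by (intro prob_some_offer_ge) (force+)
    moreover have "{L. \<exists>v\<in>snd ` B. s \<in> set (L v)} = {L. {e. s \<in> set (L (snd e))} \<inter> B \<noteq> {}}"
      by auto
    ultimately show "?\<kappa> * (\<Sum>e\<in>B. z e / real (c (fst s)))
        \<le> measure_pmf.prob P {L. {e. s \<in> set (L (snd e))} \<inter> B \<noteq> {}}"
      using sum_B by simp
  qed (use fin F_int F_nonneg F_ge in \<open>auto simp: r_def edges_at_left_def\<close>)
  have "matching_value E w x z \<le> (\<Sum>e\<in>E. r e * z e)"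
    unfolding matching_value_def r_def using z_nonneg by (intro sum_mono mult_right_mono) auto
  also have "\<dots> = (\<Sum>s\<in>?S. \<Sum>e\<in>edges_at_left E (fst s). r e * (z e / real (c (fst s))))"
    by (subst sum_edges_eq_sum_slots[OF G c]) auto
  finally have "?\<kappa> * matching_value E w x z
      \<le> ?\<kappa> * (\<Sum>s\<in>?S. \<Sum>e\<in>edges_at_left E (fst s). r e * (z e / real (c (fst s))))"
    by (rule mult_left_mono) simp
  also have "\<dots> \<le> (\<Sum>s\<in>?S. measure_pmf.expectation P (?F s))"
    unfolding sum_distrib_left[of ?\<kappa> _ ?S] by (rule sum_mono) (rule slot)
  also have "\<dots> = measure_pmf.expectation P (\<lambda>L. \<Sum>s\<in>?S. ?F s L)"
    using F_int by (simp add: Bochner_Integration.integral_sum)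
  also have "\<dots> \<le> measure_pmf.expectation P (\<lambda>L. b_matching_opt U V E w c x (\<lambda>v. length (L v)))"
  proof (rule integral_mono)
    show "integrable (measure_pmf P) (\<lambda>L. b_matching_opt U V E w c x (\<lambda>v. length (L v)))"
      using integrable_b_matching_opt[OF G, of "map_pmf (\<lambda>L v. length (L v)) P"] by simp
  qed (use F_int sum_best_offer_le_b_matching_opt[OF G] in auto)
  also have "\<dots> = measure_pmf.expectation (map_pmf (\<lambda>L. length \<circ> L) P) (b_matching_opt U V E w c x)"
    by (simp add: comp_def)
  also have "map_pmf (\<lambda>L. length \<circ> L) P = Pi_pmf V 0 D"
    unfolding P_def using fin
    by (subst Pi_pmf_map[symmetric, where dflt' = 0]) (auto simp: \<mu>_def map_length_routed_arrivals)
  finally show ?thesis .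
qed

text \<open>
  The expectation \<open>\<zeta>\<close> of almost optimal matchings is a fractional solution for the mean demands, and by
  linearity its value is their expected value. Almost optimal matchings suffice because \<open>\<epsilon>\<close> is arbitrary.
\<close>

lemma expected_b_matching_opt_le:
  fixes D :: "('v \<Rightarrow> nat) pmf"
  assumes G: "bipartite_graph U V E"
    and int: "\<And>v. v \<in> V \<Longrightarrow> integrable (measure_pmf D) (\<lambda>\<xi>. real (\<xi> v))"
    and mean: "\<And>v. v \<in> V \<Longrightarrow> measure_pmf.expectation D (\<lambda>\<xi>. real (\<xi> v)) \<le> b v"
  shows "measure_pmf.expectation D (b_matching_opt U V E w c x)
       \<le> (SUP z \<in> feasible_fractional U V E c b. matching_value E w x z)"
proof (rule field_le_epsilon)
  fix \<epsilon> :: real assume "0 < \<epsilon>"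
  have fin: "finite E" using G by (rule finite_edges)
  have "\<exists>z\<in>feasible_b_matchings U V E c \<xi>.
      b_matching_opt U V E w c x \<xi> - \<epsilon> < matching_value E w x (\<lambda>e. real (z e))" for \<xi>
    using \<open>0 < \<epsilon>\<close>
    by (subst less_cSUP_iff[OF feasible_b_matchings_nonempty bdd_above_b_matchings[OF G], symmetric])
       (simp add: b_matching_opt_def)
  then obtain z where z: "z \<xi> \<in> feasible_b_matchings U V E c \<xi>"
    and near: "b_matching_opt U V E w c x \<xi> - \<epsilon> < matching_value E w x (\<lambda>e. real (z \<xi> e))" for \<xi>
    by metis
  define \<zeta> where "\<zeta> e = measure_pmf.expectation D (\<lambda>\<xi>. real (z \<xi> e))" for e
  have left: "(\<Sum>e\<in>edges_at_left E u. real (z \<xi> e)) \<le> real (c u)" if "u \<in> U" for u \<xi>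
    using z[of \<xi>] that by (auto simp: feasible_b_matchings_def simp flip: of_nat_sum)
  have right: "(\<Sum>e\<in>edges_at_right E v. real (z \<xi> e)) \<le> real (\<xi> v)" if "v \<in> V" for v \<xi>
    using z[of \<xi>] that by (auto simp: feasible_b_matchings_def simp flip: of_nat_sum)
  have z_le: "real (z \<xi> e) \<le> real (c (fst e))" if "e \<in> E" for \<xi> e
  proof -
    have "real (z \<xi> e) \<le> (\<Sum>e\<in>edges_at_left E (fst e). real (z \<xi> e))"
      by (rule member_le_sum) (use that fin in \<open>auto simp: edges_at_left_def\<close>)
    also have "\<dots> \<le> real (c (fst e))"
      using G that by (intro left) (auto simp: bipartite_graph_def)
    finally show ?thesis .
  qed
  have z_int: "integrable (measure_pmf D) (\<lambda>\<xi>. real (z \<xi> e))" if "e \<in> E" for e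
    by (rule measure_pmf.integrable_const_bound[where B = "real (c (fst e))"])
       (use z_le[OF that] in auto)
  have sum_\<zeta>: "(\<Sum>e\<in>B. \<zeta> e) = measure_pmf.expectation D (\<lambda>\<xi>. \<Sum>e\<in>B. real (z \<xi> e))"
    if "B \<subseteq> E" for B
    unfolding \<zeta>_def using z_int that by (subst Bochner_Integration.integral_sum) auto
  have "\<zeta> \<in> feasible_fractional U V E c b"
    unfolding feasible_fractional_def
  proof (safe)
    show "0 \<le> \<zeta> e" for e
      by (simp add: \<zeta>_def)
  next
    fix v assume v: "v \<in> V"
    have sub: "edges_at_right E v \<subseteq> E" by (auto simp: edges_at_right_def)
    have "(\<Sum>e\<in>edges_at_right E v. \<zeta> e) \<le> measure_pmf.expectation D (\<lambda>\<xi>. real (\<xi> v))"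
      unfolding sum_\<zeta>[OF sub] using int[OF v] right[OF v] z_int sub
      by (intro integral_mono Bochner_Integration.integrable_sum) auto
    also have "\<dots> \<le> b v" by (rule mean[OF v])
    finally show "(\<Sum>e\<in>edges_at_right E v. \<zeta> e) \<le> b v" .
  next
    fix u assume u: "u \<in> U"
    have sub: "edges_at_left E u \<subseteq> E" by (auto simp: edges_at_left_def)
    show "(\<Sum>e\<in>edges_at_left E u. \<zeta> e) \<le> real (c u)"
      unfolding sum_\<zeta>[OF sub] using left[OF u] z_int sub
      by (intro measure_pmf.integral_le_const Bochner_Integration.integrable_sum) auto
  qed
  then have sup: "matching_value E w x \<zeta>
      \<le> (SUP z \<in> feasible_fractional U V E c b. matching_value E w x z)"
    by (intro cSUP_upper bdd_above_fractional[OF G])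
  have val_int: "integrable (measure_pmf D) (\<lambda>\<xi>. matching_value E w x (\<lambda>e. real (z \<xi> e)))"
    unfolding matching_value_def using z_int by (intro Bochner_Integration.integrable_sum) auto
  have "measure_pmf.expectation D (b_matching_opt U V E w c x)
      \<le> measure_pmf.expectation D (\<lambda>\<xi>. matching_value E w x (\<lambda>e. real (z \<xi> e)) + \<epsilon>)"
    using near val_int integrable_b_matching_opt[OF G]
    by (intro integral_mono) (auto simp: less_imp_le diff_less_eq)
  also have "\<dots> = matching_value E w x \<zeta> + \<epsilon>"
    using val_int z_int unfolding matching_value_def \<zeta>_def
    by (simp add: Bochner_Integration.integral_sum)
  finally show "measure_pmf.expectation D (b_matching_opt U V E w c x)
      \<le> (SUP z \<in> feasible_fractional U V E c b. matching_value E w x z) + \<epsilon>"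
    using sup by linarith
qed

theorem theorem2:
  fixes U :: "'u set" and V :: "'v set" and E :: "('u \<times> 'v) set"
    and w :: "'u \<times> 'v \<Rightarrow> real" and c :: "'u \<Rightarrow> nat"
    and n :: "'v \<Rightarrow> nat" and X :: "'v \<Rightarrow> real set" and p :: "'v \<Rightarrow> real \<Rightarrow> real"
    and x :: "'v \<Rightarrow> real" and m :: demand_model
  assumes "bipartite_graph U V E"
    and "\<And>u. u \<in> U \<Longrightarrow> 0 < c u"
    and "\<And>v. v \<in> V \<Longrightarrow> is_interval (X v)"
    and "\<And>v y. v \<in> V \<Longrightarrow> y \<in> X v \<Longrightarrow> p v y \<in> {0..1}"
    and "x \<in> Pi V X"
  shows "(1 - 1 / exp 1) * fluid_opt U V E w c n p x
           \<le> measure_pmf.expectation (demand_distribution m V n p x) (\<lambda>\<xi>. b_matching_opt U V E w c x \<xi>)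
       \<and> measure_pmf.expectation (demand_distribution m V n p x) (\<lambda>\<xi>. b_matching_opt U V E w c x \<xi>)
           \<le> fluid_opt U V E w c n p x"
proof
  let ?b = "\<lambda>v. mean_demand n p v (x v)" and ?D = "demand_distribution m V n p x"
  let ?\<kappa> = "1 - 1 / exp 1 :: real"
  have G: "bipartite_graph U V E" by (rule assms(1))
  then have finV: "finite V" by (simp add: bipartite_graph_def)
  have p01: "p v (x v) \<in> {0..1}" if "v \<in> V" for v
    using assms(4,5) that by (auto simp: Pi_def)
  have b_nonneg: "0 \<le> ?b v" if "v \<in> V" for v
    using p01[OF that] by (simp add: mean_demand_def)
  have \<kappa>_pos: "0 < ?\<kappa>" by simp
  have "fluid_opt U V E w c n p x \<le> measure_pmf.expectation ?D (b_matching_opt U V E w c x) / ?\<kappa>"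
    unfolding fluid_opt_def
  proof (rule cSUP_least[OF feasible_fractional_nonempty])
    fix z assume z: "z \<in> feasible_fractional U V E c ?b"
    have "?\<kappa> * matching_value E w x z \<le> measure_pmf.expectation ?D (b_matching_opt U V E w c x)"
      unfolding demand_distribution_def
      by (rule fractional_le_expected_b_matching_opt[OF G assms(2) z])
         (assumption, rule demand_pmf_thinned_zero[of p _ x, OF p01])
    then show "matching_value E w x z \<le> measure_pmf.expectation ?D (b_matching_opt U V E w c x) / ?\<kappa>"
      using \<kappa>_pos by (simp only: pos_le_divide_eq mult.commute)
  qed (rule b_nonneg)
  then show "?\<kappa> * fluid_opt U V E w c n p x
      \<le> measure_pmf.expectation ?D (\<lambda>\<xi>. b_matching_opt U V E w c x \<xi>)"
    using \<kappa>_pos by (simp only: pos_le_divide_eq mult.commute)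
  have comp: "map_pmf (\<lambda>\<xi>. \<xi> v) ?D = demand_pmf m n p x v" if "v \<in> V" for v
    using that finV by (simp add: demand_distribution_def Pi_pmf_component)
  show "measure_pmf.expectation ?D (\<lambda>\<xi>. b_matching_opt U V E w c x \<xi>) \<le> fluid_opt U V E w c n p x"
    unfolding fluid_opt_def
  proof (rule expected_b_matching_opt_le[OF G])
    fix v assume v: "v \<in> V"
    show "integrable (measure_pmf ?D) (\<lambda>\<xi>. real (\<xi> v))"
      using demand_pmf_mean(1)[of p v x m n, OF p01[OF v]] unfolding comp[OF v, symmetric] by simp
    show "measure_pmf.expectation ?D (\<lambda>\<xi>. real (\<xi> v)) \<le> ?b v"
      using demand_pmf_mean(2)[of p v x m n, OF p01[OF v]] unfolding comp[OF v, symmetric] by simp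
  qed
qed

end
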